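(* The average path lengths $\bar D(t)$ of the networks $G_t$ (defined in the context) satisfy $$\lim_{t\to\infty}\frac{\bar D(t)}{t}=\frac{4}{9}.$$
   Context: Let $K\subset\mathbb{R}^2$ be the solid regular triangle with vertices $a_1=(0,0)$, $a_2=(1,0)$, $a_3=(1/2,\sqrt3/2)$, and let $T_i(x)=x/2+a_i/2$ for $i=1,2,3$. A word is a finite (possibly empty) sequence $\sigma=i_1\cdots i_k$ of letters in $\{1,2,3\}$, of length $|\sigma|=k$; the empty word $\emptyset$ has length $0$. Put $T_\sigma=T_{i_1}\circ\cdots\circ T_{i_k}$, $K_\sigma=T_\sigma(K)$, $K_\emptyset=K$, and let $\partial K_\sigma$ be the boundary of the solid triangle $K_\sigma$ (the union of its three sides). For distinct words $\sigma,\tau$ write $\sigma\sim\tau$ if $\partial K_\sigma\cap\partial K_\tau\neq\varnothing$. For each integer $t\ge 0$, $G_t$ is the simple graph with vertex set $V_t=\{\sigma:0\le|\sigma|\le t\}$ (so $\#V_t=\frac12(3^{t+1}-1)$) and with an edge between distinct words $\sigma,\tau\in V_t$ if and only if $\sigma\sim\tau$. Let $d_t$ be the geodesic (shortest path) distance in $G_t$. For $t\ge1$ the average path length is $$\bar D(t)=\frac{\sum_{\sigma\ne\tau\in V_t}d_t(\sigma,\tau)}{\#V_t(\#V_t-1)/2},$$ where the sum is over unordered pairs of distinct vertices. *)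

theory Defs
  imports "HOL-Analysis.Analysis" "Graph_Theory.Graph_Theory"
begin

datatype letter = L1 | L2 | L3

type_synonym word = "letter list"

primrec corner :: "letter \<Rightarrow> real ^ 2" where
  "corner L1 = vector [0, 0]"
| "corner L2 = vector [1, 0]"
| "corner L3 = vector [1 / 2, sqrt 3 / 2]"

definition solid_triangle :: "(real ^ 2) set" where
  "solid_triangle = convex hull {corner L1, corner L2, corner L3}"

definition contraction :: "letter \<Rightarrow> real ^ 2 \<Rightarrow> real ^ 2" where
  "contraction i x = (1 / 2) *\<^sub>R x + (1 / 2) *\<^sub>R corner i"

primrec word_map :: "word \<Rightarrow> real ^ 2 \<Rightarrow> real ^ 2" where
  "word_map [] = id"
| "word_map (i # \<sigma>) = contraction i \<circ> word_map \<sigma>"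

definition cell :: "word \<Rightarrow> (real ^ 2) set" where
  "cell \<sigma> = word_map \<sigma> ` solid_triangle"

definition touching :: "word \<Rightarrow> word \<Rightarrow> bool" where
  "touching \<sigma> \<tau> \<longleftrightarrow> \<sigma> \<noteq> \<tau> \<and> frontier (cell \<sigma>) \<inter> frontier (cell \<tau>) \<noteq> {}"

definition words_upto :: "nat \<Rightarrow> word set" where
  "words_upto t = {\<sigma>. length \<sigma> \<le> t}"

text \<open>As usual in the library, a simple graph is a finite symmetric loop-free digraph
  (locale \<^locale>\<open>pair_graph\<close>): an edge is represented by its two opposite arcs.\<close>

definition sierpinski_graph :: "nat \<Rightarrow> word pair_pre_digraph" where
  "sierpinski_graph t =
     \<lparr> pverts = words_upto t,
       parcs = {(\<sigma>, \<tau>). \<sigma> \<in> words_upto t \<and> \<tau> \<in> words_upto t \<and> touching \<sigma> \<tau>} \<rparr>"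

text \<open>Geodesic distance is the minimal cost of a walk when each arc has cost one. The library
  function is extended-real valued; on vertices of the graph the value is finite, because
  the graph is connected (lemma \<open>sierpinski_dist_ereal\<close> below).\<close>

definition sierpinski_dist :: "nat \<Rightarrow> word \<Rightarrow> word \<Rightarrow> real" where
  "sierpinski_dist t \<sigma> \<tau> =
     real_of_ereal (wf_digraph.\<mu> (with_proj (sierpinski_graph t)) (\<lambda>_. 1) \<sigma> \<tau>)"

text \<open>The double sum ranges over ordered pairs, so each unordered pair occurs twice
  (lemma \<open>sierpinski_dist_commute\<close> below); halving it gives the sum over unordered pairs.\<close>

definition average_path_length :: "nat \<Rightarrow> real" where
  "average_path_length t =
     ((\<Sum>\<sigma>\<in>words_upto t. \<Sum>\<tau>\<in>words_upto t - {\<sigma>}. sierpinski_dist t \<sigma> \<tau>) / 2) /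
     (real (card (words_upto t)) * (real (card (words_upto t)) - 1) / 2)"


lemma UNIV_letter: "(UNIV :: letter set) = {L1, L2, L3}"
  by (auto intro: letter.exhaust)

lemma finite_words_upto: "finite (words_upto t)"
proof -
  have "words_upto t = {\<sigma>. set \<sigma> \<subseteq> (UNIV :: letter set) \<and> length \<sigma> \<le> t}"
    by (simp add: words_upto_def)
  then show ?thesis
    using finite_lists_length_le[of "UNIV :: letter set" t] by (simp add: UNIV_letter)
qed

lemma card_words_upto: "2 * card (words_upto t) = 3 ^ (t + 1) - 1"
proof -
  have "words_upto t = {\<sigma>. set \<sigma> \<subseteq> (UNIV :: letter set) \<and> length \<sigma> \<le> t}"
    by (simp add: words_upto_def)
  then have c: "card (words_upto t) = (\<Sum>i\<le>t. 3 ^ i)"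
    using card_lists_length_le[of "UNIV :: letter set" t] by (simp add: UNIV_letter numeral_3_eq_3)
  have "2 * (\<Sum>i\<le>t. 3 ^ i) + 1 = (3 :: nat) ^ (t + 1)"
    by (induction t) auto
  with c show ?thesis by simp
qed

lemma pair_graph_sierpinski: "pair_graph (sierpinski_graph t)"
proof -
  have "finite (parcs (sierpinski_graph t))"
    by (rule finite_subset[of _ "words_upto t \<times> words_upto t"])
       (auto simp: sierpinski_graph_def finite_words_upto)
  then show ?thesis
    by unfold_locales
       (auto simp: sierpinski_graph_def finite_words_upto touching_def symmetric_def sym_def)
qed

lemma frontier_contraction: "frontier (contraction i ` S) = contraction i ` frontier S"
proof -
  have im: "contraction i ` A =
      (\<lambda>x. (1 / 2) *\<^sub>R corner i + x) ` ((*\<^sub>R) (1 / 2) ` A)" for A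
    by (auto simp: contraction_def image_image add.commute)
  have lin: "linear ((*\<^sub>R) (1 / 2) :: real ^ 2 \<Rightarrow> real ^ 2)" "inj ((*\<^sub>R) (1 / 2) :: real ^ 2 \<Rightarrow> real ^ 2)"
    by (auto intro: injI bounded_linear.linear bounded_linear_scaleR_right)
  have d: "f ` (A - B) = f ` A - f ` B" if "inj f" for f :: "real ^ 2 \<Rightarrow> real ^ 2" and A B
    using that by (simp add: image_set_diff)
  show ?thesis
    unfolding im frontier_def closure_translation interior_translation
      closure_injective_linear_image[OF lin, symmetric] interior_injective_linear_image[OF lin]
    by (simp add: d[OF lin(2)] d)
qed

lemma corner_in_frontier: "corner i \<in> frontier solid_triangle"
proof -
  have nots: "corner i \<notin> interior solid_triangle"
    if "n \<noteq> 0" "\<And>j. n \<bullet> corner j \<le> b" "n \<bullet> corner i = b" for n b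
  proof -
    have "solid_triangle \<subseteq> {x. n \<bullet> x \<le> b}"
      unfolding solid_triangle_def
      by (intro hull_minimal convex_halfspace_le) (use that in \<open>auto simp del: corner.simps\<close>)
    then have "interior solid_triangle \<subseteq> {x. n \<bullet> x < b}"
      using interior_mono interior_halfspace_le[OF that(1)] by blast
    then show ?thesis using that by auto
  qed
  have ne: "axis 2 c \<noteq> (0 :: real ^ 2)" if "c \<noteq> 0" for c
    using that by (simp add: axis_eq_0_iff)
  have inn: "axis 2 c \<bullet> (vector [x, y] :: real ^ 2) = c * y" for c x y
    by (simp add: inner_axis')
  have "corner i \<notin> interior solid_triangle"
  proof (cases "i = L3")
    case True
    show ?thesis
    proof (rule nots[of "axis 2 1" "sqrt 3 / 2"])
      show "axis 2 1 \<bullet> corner j \<le> sqrt 3 / 2" for j by (cases j) (auto simp: inn)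
    qed (use True in \<open>auto simp: inn ne\<close>)
  next
    case False
    show ?thesis
    proof (rule nots[of "axis 2 (- 1)" 0])
      show "axis 2 (- 1) \<bullet> corner j \<le> 0" for j by (cases j) (auto simp: inn)
    qed (use False in \<open>cases i; auto simp: inn ne\<close>)+
  qed
  moreover have "corner i \<in> solid_triangle"
    unfolding solid_triangle_def by (rule hull_inc) (cases i; simp)
  ultimately show ?thesis
    using closure_subset by (auto simp: frontier_def)
qed

lemma frontier_cell: "frontier (cell \<sigma>) = word_map \<sigma> ` frontier solid_triangle"
proof (induction \<sigma>)
  case Nil
  show ?case by (simp add: cell_def)
next
  case (Cons i \<sigma>)
  have "cell (i # \<sigma>) = contraction i ` cell \<sigma>"
    by (simp add: cell_def image_comp)
  then show ?case by (simp add: frontier_contraction Cons.IH image_comp)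
qed

lemma word_map_append: "word_map (\<sigma> @ \<tau>) = word_map \<sigma> \<circ> word_map \<tau>"
  by (induction \<sigma>) (simp_all add: comp_assoc)

lemma touching_snoc: "touching \<sigma> (\<sigma> @ [i])"
proof -
  have "contraction i (corner i) = corner i"
    by (simp add: contraction_def scaleR_add_left[symmetric])
  then have "word_map (\<sigma> @ [i]) (corner i) = word_map \<sigma> (corner i)"
    by (simp add: word_map_append)
  then have "word_map \<sigma> (corner i) \<in> frontier (cell \<sigma>) \<inter> frontier (cell (\<sigma> @ [i]))"
    using corner_in_frontier[of i] by (auto simp: frontier_cell intro: rev_image_eqI)
  then show ?thesis by (auto simp: touching_def)
qed

lemma sierpinski_reachable:
  assumes "\<sigma> \<in> words_upto t" "\<tau> \<in> words_upto t"
  shows "\<sigma> \<rightarrow>\<^sup>*\<^bsub>with_proj (sierpinski_graph t)\<^esub> \<tau>"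
proof -
  interpret pair_graph "sierpinski_graph t" by (rule pair_graph_sierpinski)
  have root: "[] \<rightarrow>\<^sup>*\<^bsub>with_proj (sierpinski_graph t)\<^esub> \<rho>" if "\<rho> \<in> words_upto t" for \<rho>
    using that
  proof (induction \<rho> rule: rev_induct)
    case Nil
    then have "[] \<in> pverts (sierpinski_graph t)" by (simp add: sierpinski_graph_def)
    then show ?case by simp
  next
    case (snoc i \<rho>)
    then have "\<rho> \<in> words_upto t" by (simp add: words_upto_def)
    with snoc have "(\<rho>, \<rho> @ [i]) \<in> parcs (sierpinski_graph t)"
      by (simp add: sierpinski_graph_def touching_snoc)
    with snoc.IH[OF \<open>\<rho> \<in> words_upto t\<close>] show ?case
      by (simp add: reachable_adj_trans)
  qed
  show ?thesis
    using root[OF assms(1)] root[OF assms(2)] symmetric_reachable[OF sym_arcs] reachable_trans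
    by blast
qed

lemma sierpinski_dist_ereal:
  assumes "\<sigma> \<in> words_upto t" "\<tau> \<in> words_upto t"
  shows "ereal (sierpinski_dist t \<sigma> \<tau>) =
    wf_digraph.\<mu> (with_proj (sierpinski_graph t)) (\<lambda>_. 1) \<sigma> \<tau>"
proof -
  interpret pair_graph "sierpinski_graph t" by (rule pair_graph_sierpinski)
  obtain p where p: "awalk \<sigma> p \<tau>"
    using sierpinski_reachable[OF assms] by (auto simp: reachable_awalk)
  have "\<mu> (\<lambda>_. 1) \<sigma> \<tau> \<le> ereal (awalk_cost (\<lambda>_. 1) p)"
    by (rule min_cost_le_walk_cost[OF p])
  moreover have "0 \<le> \<mu> (\<lambda>_. 1) \<sigma> \<tau>"
    unfolding \<mu>_def by (rule INF_greatest) (auto intro: pos_cost_pos_awalk_cost)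
  ultimately have "\<bar>\<mu> (\<lambda>_. 1) \<sigma> \<tau>\<bar> \<noteq> \<infinity>" by auto
  then show ?thesis
    unfolding sierpinski_dist_def by (simp add: ereal_real)
qed

lemma sierpinski_dist_commute: "sierpinski_dist t \<sigma> \<tau> = sierpinski_dist t \<tau> \<sigma>"
proof -
  interpret pair_graph "sierpinski_graph t" by (rule pair_graph_sierpinski)
  have rev: "\<exists>q. awalk v q u \<and> length q = length p" if "awalk u p v" for u v p
    using that
  proof (induction p arbitrary: u)
    case Nil
    then show ?case by (auto simp: awalk_Nil_iff)
  next
    case (Cons e p)
    then have e: "e \<in> parcs (sierpinski_graph t)" "u = fst e" "awalk (snd e) p v"
      by (auto simp: awalk_Cons_iff)
    from Cons.IH[OF e(3)] obtain q where q: "awalk v q (snd e)" "length q = length p"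
      by blast
    have "(snd e, fst e) \<in> parcs (sierpinski_graph t)"
      using e(1) by (auto simp: sierpinski_graph_def touching_def)
    then have "awalk (snd e) [(snd e, fst e)] u"
      using e(2) arc_fst_in_verts[OF e(1)] by (auto simp: awalk_Cons_iff awalk_Nil_iff)
    with q show ?case by (intro exI[of _ "q @ [(snd e, fst e)]"]) (auto intro: awalk_appendI)
  qed
  have cost: "awalk_cost (\<lambda>_. 1) p = real (length p)" for p
    by (induction p) auto
  have le: "\<mu> (\<lambda>_. 1) u v \<le> \<mu> (\<lambda>_. 1) v u" for u v
    unfolding \<mu>_def by (rule INF_mono) (use rev in \<open>fastforce simp: cost\<close>)
  show ?thesis
    unfolding sierpinski_dist_def using le[of \<sigma> \<tau>] le[of \<tau> \<sigma>] by simp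
qed

end

theory Submission
  imports Defs "HOL-Library.Sublist" "HOL-Real_Asymp.Real_Asymp"
begin

text \<open>
  Two words touch only if, after removal of a common prefix, each of them omits some letter; and
  \<open>\<rho> @ w\<close> touches \<open>\<rho>\<close> whenever the nonempty word \<open>w\<close> omits a letter. Both facts are read off from
  barycentric coordinates: halving towards a corner halves two of the coordinates and makes the
  third positive, so a coordinate vanishes somewhere on the cell of \<open>w\<close> exactly if \<open>w\<close> omits the
  corresponding letter (\<open>touching_suffixes\<close>, \<open>touching_append\<close>).

  Cut a word greedily from the left into as few blocks as possible, each omitting a letter, and let
  \<open>blocks\<close> count them. Deleting the blocks one by one from the right walks to the empty word, so
  \<open>d(\<sigma>, \<tau>) \<le> blocks \<sigma> + blocks \<tau>\<close>. Conversely, by the description of touching words, \<open>blocks\<close> changes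
  by at most one along an edge. If \<open>\<rho>\<close> is the longest common prefix of \<open>\<sigma>\<close> and \<open>\<tau>\<close>, with next letter \<open>i\<close>
  in \<open>\<sigma>\<close>, then every edge out of the set of words that begin with \<open>\<rho> @ [i]\<close> joins two words with at
  most \<open>blocks \<rho> + 1\<close> blocks. This gives
  \<open>d(\<sigma>, \<tau>) \<ge> blocks \<sigma> + blocks \<tau> - 2 |\<rho>| - 2\<close> (\<open>blocks_le_dist\<close>). A common prefix of length at least
  \<open>m\<close> is shared by a fraction of at most \<open>1 / 3 ^ m\<close> of all pairs, so the mean of \<open>|\<rho>|\<close> is at most \<open>1/2\<close>
  and the average path length is twice the mean of \<open>blocks\<close> up to a bounded error.

  The mean of \<open>blocks\<close> comes from a two-state chain: a block with one distinct letter keeps one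
  with probability \<open>1/3\<close> and gets a second with probability \<open>2/3\<close>; a block with two distinct letters
  is closed by the next letter with probability \<open>1/3\<close>. The stationary weights are \<open>1/3\<close> and \<open>2/3\<close>, so
  a new block starts at the rate \<open>2/3 \<cdot> 1/3 = 2/9\<close> per letter. Since most words of length at most
  \<open>t\<close> have length close to \<open>t\<close>, the mean of \<open>blocks\<close> is asymptotic to \<open>2t/9\<close>, and the limit is
  \<open>2 \<cdot> 2/9 = 4/9\<close>. The exact sum of \<open>blocks\<close> is found in \<open>sum_blocks\<close>.
\<close>

section \<open>Barycentric coordinates and touching cells\<close>

primrec bary :: "letter \<Rightarrow> real ^ 2 \<Rightarrow> real" where
  "bary L1 x = 1 - x $ 1 - x $ 2 / sqrt 3"
| "bary L2 x = x $ 1 - x $ 2 / sqrt 3"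
| "bary L3 x = 2 * x $ 2 / sqrt 3"

lemma sum_letter: "(\<Sum>x\<in>UNIV. h x) = h L1 + h L2 + h L3" for h :: "letter \<Rightarrow> 'a::comm_monoid_add"
  by (simp add: UNIV_letter add.assoc)

lemma card_UNIV_letter: "card (UNIV :: letter set) = 3"
  by (simp add: UNIV_letter)

lemma all_letter: "(\<forall>k. P k) \<longleftrightarrow> P L1 \<and> P L2 \<and> P L3"
  using letter.exhaust by metis

lemma bary_sum: "bary L1 x + bary L2 x + bary L3 x = 1"
  by (simp add: field_simps)

lemma bary_affine:
  assumes "a + b = 1"
  shows "bary k (a *\<^sub>R x + b *\<^sub>R y) = a * bary k x + b * bary k y"
proof -
  have b: "b = 1 - a" using assms by simp
  show ?thesis by (cases k) (simp_all add: b algebra_simps add_divide_distrib diff_divide_distrib)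
qed

lemma bary_corner: "bary k (corner i) = (if k = i then 1 else 0)"
  by (cases k; cases i) (simp_all add: field_simps)

lemma bary_contraction: "bary k (contraction i x) = bary k x / 2 + (if k = i then 1 / 2 else 0)"
  unfolding contraction_def by (subst bary_affine) (simp_all add: bary_corner)

text \<open>This form lets the library facts on half-spaces supply openness and interiors.\<close>

lemma bary_inner:
  obtains n c where "n \<noteq> 0" "\<And>x. bary k x = n \<bullet> x + c"
proof (cases k)
  case L1
  show ?thesis
    by (rule that[of "vector [-1, -1 / sqrt 3]" 1])
       (simp_all add: L1 inner_vec_def sum_2 vec_eq_iff forall_2)
next
  case L2
  show ?thesis
    by (rule that[of "vector [1, -1 / sqrt 3]" 0])
       (simp_all add: L2 inner_vec_def sum_2 vec_eq_iff forall_2)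
next
  case L3
  show ?thesis
    by (rule that[of "vector [0, 2 / sqrt 3]" 0])
       (simp_all add: L3 inner_vec_def sum_2 vec_eq_iff forall_2)
qed

lemma solid_triangle_bary: "solid_triangle = {x. \<forall>k. 0 \<le> bary k x}"
proof
  have "convex {x. 0 \<le> bary k x}" for k
    unfolding convex_def by (auto simp: bary_affine)
  then have "convex (\<Inter>k. {x. 0 \<le> bary k x})"
    by (intro convex_INT) auto
  then have "convex hull {corner L1, corner L2, corner L3} \<subseteq> (\<Inter>k. {x. 0 \<le> bary k x})"
    by (intro hull_minimal) (auto simp: bary_corner simp del: corner.simps)
  then show "solid_triangle \<subseteq> {x. \<forall>k. 0 \<le> bary k x}"
    by (auto simp: solid_triangle_def)
  show "{x. \<forall>k. 0 \<le> bary k x} \<subseteq> solid_triangle"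
  proof
    fix x :: "real ^ 2"
    assume x: "x \<in> {x. \<forall>k. 0 \<le> bary k x}"
    have "x = bary L1 x *\<^sub>R corner L1 + bary L2 x *\<^sub>R corner L2 + bary L3 x *\<^sub>R corner L3"
      by (simp add: vec_eq_iff forall_2 field_simps)
    with x bary_sum[of x] show "x \<in> solid_triangle"
      unfolding solid_triangle_def convex_hull_3 by blast
  qed
qed

lemma frontier_solid_triangle:
  "frontier solid_triangle = {x \<in> solid_triangle. \<exists>k. bary k x = 0}"
proof -
  have "closed solid_triangle"
    unfolding solid_triangle_def by (intro compact_imp_closed finite_imp_compact_convex_hull) simp
  moreover have "interior solid_triangle = {x. \<forall>k. 0 < bary k x}"
  proof
    have int: "interior {x. 0 \<le> bary k x} = {x. 0 < bary k x}" for k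
    proof -
      obtain n c where n: "n \<noteq> 0" "\<And>x. bary k x = n \<bullet> x + c" using bary_inner[of k] by blast
      have "{x. 0 \<le> bary k x} = {x. n \<bullet> x \<ge> - c}" "{x. 0 < bary k x} = {x. n \<bullet> x > - c}"
        by (auto simp: n(2))
      then show ?thesis using interior_halfspace_ge[OF n(1)] by simp
    qed
    have "interior solid_triangle \<subseteq> interior {x. 0 \<le> bary k x}" for k
      by (intro interior_mono) (auto simp: solid_triangle_bary)
    then show "interior solid_triangle \<subseteq> {x. \<forall>k. 0 < bary k x}"
      unfolding int by blast
    have "open {x. 0 < bary k x}" for k
      using int[of k] open_interior by metis
    then have "open ({x. 0 < bary L1 x} \<inter> {x. 0 < bary L2 x} \<inter> {x. 0 < bary L3 x})"
      by (intro open_Int)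
    also have "\<dots> = {x. \<forall>k. 0 < bary k x}"
      by (auto simp del: bary.simps simp: all_letter)
    finally show "{x. \<forall>k. 0 < bary k x} \<subseteq> interior solid_triangle"
      by (intro interior_maximal) (auto simp: solid_triangle_bary intro: less_imp_le)
  qed
  moreover have "(\<forall>k. 0 < bary k x) \<longleftrightarrow> (\<forall>k. 0 \<le> bary k x) \<and> (\<forall>k. bary k x \<noteq> 0)" for x
    by (metis less_le)
  ultimately show ?thesis
    by (auto simp: frontier_def solid_triangle_bary)
qed

lemma word_map_in_solid_triangle:
  "x \<in> solid_triangle \<Longrightarrow> word_map w x \<in> solid_triangle"
  by (induction w) (auto simp: solid_triangle_bary bary_contraction)

text \<open>A letter \<open>k\<close> in \<open>w\<close> adds a positive amount to the coordinate at \<open>k\<close>, and no later contraction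
  can take it back to zero.\<close>

lemma bary_word_map_eq_0:
  assumes "x \<in> solid_triangle"
  shows "bary k (word_map w x) = 0 \<longleftrightarrow> k \<notin> set w \<and> bary k x = 0"
proof (induction w)
  case (Cons i w)
  have "0 \<le> bary k (word_map w x)"
    using word_map_in_solid_triangle[OF assms] by (simp add: solid_triangle_bary)
  with Cons show ?case by (auto simp: bary_contraction)
qed simp

lemma inj_word_map: "inj (word_map w)"
proof (induction w)
  case (Cons i w)
  have "inj (contraction i)" by (auto simp: contraction_def inj_def)
  with Cons show ?case by (simp add: inj_compose del: o_apply)
qed simp

text \<open>If \<open>w\<close> omits \<open>k\<close>, its cell reaches the side of the large triangle opposite to corner \<open>k\<close>: it
  maps every other corner into that side.\<close>

lemma touching_append:
  assumes "set w \<noteq> UNIV" "w \<noteq> []"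
  shows "touching (\<rho> @ w) \<rho>"
proof -
  obtain k where k: "k \<notin> set w" using assms(1) by auto
  obtain j where j: "j \<noteq> k" by (metis letter.distinct(1))
  have c: "corner j \<in> solid_triangle"
    using corner_in_frontier by (simp add: frontier_solid_triangle)
  have "word_map w (corner j) \<in> frontier solid_triangle"
    using k j bary_word_map_eq_0[OF c, of k w] word_map_in_solid_triangle[OF c]
    by (auto simp: frontier_solid_triangle bary_corner simp del: corner.simps)
  then have "word_map (\<rho> @ w) (corner j) \<in> frontier (cell (\<rho> @ w)) \<inter> frontier (cell \<rho>)"
    using corner_in_frontier[of j] by (simp add: frontier_cell) (simp add: word_map_append)
  with assms(2) show ?thesis by (auto simp: touching_def)
qed

text \<open>Let \<open>\<rho>\<close> be the longest common prefix. Seen from the cell of \<open>\<rho>\<close>, a common boundary point lies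
  on a side of the triangle: this is clear if one of the words equals \<open>\<rho>\<close>, and otherwise two of its
  coordinates are at least \<open>1/2\<close>, which leaves zero for the third. The letter of the vanishing
  coordinate is then missing from both suffixes.\<close>

lemma touching_suffixes:
  assumes "touching \<sigma> \<tau>"
  obtains \<rho> u v where "\<sigma> = \<rho> @ u" "\<tau> = \<rho> @ v" "set u \<noteq> UNIV" "set v \<noteq> UNIV"
proof -
  define \<rho> where "\<rho> = longest_common_prefix \<sigma> \<tau>"
  obtain u v where uv: "\<sigma> = \<rho> @ u" "\<tau> = \<rho> @ v"
    using longest_common_prefix_prefix1 longest_common_prefix_prefix2
    unfolding \<rho>_def prefix_def by metis
  have hd: "i \<noteq> j" if "u = i # u'" "v = j # v'" for i j u' v'
  proof
    assume "i = j"
    then have "prefix (\<rho> @ [i]) \<sigma>" "prefix (\<rho> @ [i]) \<tau>"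
      using that uv by auto
    then have "prefix (\<rho> @ [i]) \<rho>"
      unfolding \<rho>_def by (rule longest_common_prefix_max_prefix)
    then show False by (auto dest: prefix_length_le)
  qed
  obtain x y where x: "x \<in> frontier solid_triangle" and y: "y \<in> frontier solid_triangle"
    and "word_map \<rho> (word_map u x) = word_map \<rho> (word_map v y)"
    using assms by (auto simp: touching_def frontier_cell uv word_map_append)
  then have q: "word_map u x = word_map v y"
    using inj_word_map by (simp add: inj_eq)
  have xy: "x \<in> solid_triangle" "y \<in> solid_triangle"
    using x y by (simp_all add: frontier_solid_triangle)
  have "\<exists>k. bary k (word_map u x) = 0"
  proof (cases u)
    case Nil
    then show ?thesis using x by (simp add: frontier_solid_triangle)
  next
    case u: (Cons i u')
    show ?thesis
    proof (cases v)
      case Nil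
      then show ?thesis using y q by (simp add: frontier_solid_triangle)
    next
      case v: (Cons j v')
      have half: "1 / 2 \<le> bary l (word_map (l # w) z)" if "z \<in> solid_triangle" for l w z
        using word_map_in_solid_triangle[OF that, of w]
        by (simp add: bary_contraction solid_triangle_bary)
      have "1 / 2 \<le> bary i (word_map u x)" "1 / 2 \<le> bary j (word_map u x)"
        using half[OF xy(1), of i u'] half[OF xy(2), of j v'] by (simp_all only: flip: u v q)
      moreover have "\<forall>k. 0 \<le> bary k (word_map u x)"
        using word_map_in_solid_triangle[OF xy(1)] by (simp add: solid_triangle_bary)
      moreover note bary_sum[of "word_map u x"]
      ultimately show ?thesis
        using hd[OF u v]
        by (cases i; cases j; simp only: all_letter simp_thms letter.distinct)
           (rule exI[of _ L1] exI[of _ L2] exI[of _ L3], linarith)+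
    qed
  qed
  then obtain k where "bary k (word_map u x) = 0" "bary k (word_map v y) = 0"
    using q by auto
  then have "k \<notin> set u" "k \<notin> set v"
    using bary_word_map_eq_0 xy by blast+
  with uv show ?thesis by (intro that) auto
qed

section \<open>Greedy decomposition into blocks that omit a letter\<close>

text \<open>The number of blocks that start inside the word if it continues a block whose set of letters
  is the first argument.\<close>

primrec block_starts :: "letter set \<Rightarrow> word \<Rightarrow> nat" where
  "block_starts S [] = 0"
| "block_starts S (x # w) =
     (if insert x S = UNIV then Suc (block_starts {x} w) else block_starts (insert x S) w)"

text \<open>A block that already contains all letters cannot be continued, so starting from \<open>UNIV\<close> makes the
  first letter open the first block.\<close>

definition blocks :: "word \<Rightarrow> nat" where
  "blocks = block_starts UNIV"

lemma singleton_ne_UNIV_letter [simp]: "{x} \<noteq> (UNIV :: letter set)"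
  by (cases x) (auto simp: UNIV_letter)

text \<open>The greedy scan passes from \<open>u\<close> to \<open>v\<close> through a state that depends on \<open>u\<close> only.\<close>

lemma block_starts_append: "\<exists>S'. \<forall>v. block_starts S (u @ v) = block_starts S u + block_starts S' v"
proof (induction u arbitrary: S)
  case Nil
  show ?case by auto
next
  case (Cons x u)
  obtain S' where "\<forall>v. block_starts (if insert x S = UNIV then {x} else insert x S) (u @ v) =
      block_starts (if insert x S = UNIV then {x} else insert x S) u + block_starts S' v"
    using Cons by blast
  then have "\<forall>v. block_starts S ((x # u) @ v) = block_starts S (x # u) + block_starts S' v"
    by (simp split: if_split_asm)
  then show ?case ..
qed

lemma block_starts_eq_0: "S \<union> set v \<noteq> UNIV \<Longrightarrow> block_starts S v = 0"
proof (induction v arbitrary: S)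
  case (Cons x v)
  then have "insert x S \<noteq> UNIV" "insert x S \<union> set v \<noteq> UNIV" by auto
  with Cons.IH show ?case by simp
qed simp

lemma block_starts_le_1: "set v \<noteq> UNIV \<Longrightarrow> block_starts S v \<le> 1"
proof (induction v arbitrary: S)
  case (Cons x v)
  from Cons.prems have "block_starts {x} v = 0" by (intro block_starts_eq_0) simp
  moreover from Cons.prems have "set v \<noteq> UNIV" by auto
  ultimately show ?case using Cons.IH by simp
qed simp

lemma blocks_append_ge: "blocks u \<le> blocks (u @ v)"
  using block_starts_append[of UNIV u] by (auto simp: blocks_def)

lemma blocks_append_le: "set v \<noteq> UNIV \<Longrightarrow> blocks (u @ v) \<le> blocks u + 1"
  using block_starts_append[of UNIV u] block_starts_le_1[of v] unfolding blocks_def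
  by (metis add_left_mono)

lemma blocks_le_length: "blocks w \<le> length w"
proof -
  have "block_starts S w \<le> length w" for S
    by (induction w arbitrary: S) (auto intro: le_SucI)
  then show ?thesis by (simp add: blocks_def)
qed

text \<open>The statement refers to a general state because the induction on the word changes the state:
  either no block starts inside \<open>w\<close>, and \<open>w\<close> still fits into the current one, or the last block
  lies inside \<open>w\<close> and can be split off.\<close>

lemma block_starts_last_block:
  "block_starts S w = 0 \<and> (w = [] \<or> S \<union> set w \<noteq> UNIV) \<or>
   (\<exists>w' b. w = w' @ b \<and> b \<noteq> [] \<and> set b \<noteq> UNIV \<and> block_starts S w = Suc (block_starts S w'))"
proof (induction w arbitrary: S)
  case (Cons x w)
  show ?case
  proof (cases "insert x S = UNIV")
    case True
    from Cons[of "{x}"] show ?thesis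
    proof (elim disjE)
      assume "block_starts {x} w = 0 \<and> (w = [] \<or> {x} \<union> set w \<noteq> UNIV)"
      then have "x # w = [] @ (x # w) \<and> x # w \<noteq> [] \<and> set (x # w) \<noteq> UNIV \<and>
          block_starts S (x # w) = Suc (block_starts S [])"
        using True by auto
      then show ?thesis by blast
    next
      assume "\<exists>w' b. w = w' @ b \<and> b \<noteq> [] \<and> set b \<noteq> UNIV \<and> block_starts {x} w = Suc (block_starts {x} w')"
      then obtain w' b where "w = w' @ b" "b \<noteq> []" "set b \<noteq> UNIV" "block_starts {x} w = Suc (block_starts {x} w')"
        by blast
      then have "x # w = (x # w') @ b \<and> b \<noteq> [] \<and> set b \<noteq> UNIV \<and>
          block_starts S (x # w) = Suc (block_starts S (x # w'))"
        using True by simp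
      then show ?thesis by blast
    qed
  next
    case False
    from Cons[of "insert x S"] show ?thesis
    proof (elim disjE)
      assume "block_starts (insert x S) w = 0 \<and> (w = [] \<or> insert x S \<union> set w \<noteq> UNIV)"
      then show ?thesis using False by auto
    next
      assume "\<exists>w' b. w = w' @ b \<and> b \<noteq> [] \<and> set b \<noteq> UNIV \<and>
        block_starts (insert x S) w = Suc (block_starts (insert x S) w')"
      then obtain w' b where "w = w' @ b" "b \<noteq> []" "set b \<noteq> UNIV"
          "block_starts (insert x S) w = Suc (block_starts (insert x S) w')"
        by blast
      then have "x # w = (x # w') @ b \<and> b \<noteq> [] \<and> set b \<noteq> UNIV \<and>
          block_starts S (x # w) = Suc (block_starts S (x # w'))"
        using False by simp
      then show ?thesis by blast
    qed
  qed
qed simp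

lemma blocks_last_block:
  assumes "w \<noteq> []"
  obtains w' b where "w = w' @ b" "b \<noteq> []" "set b \<noteq> UNIV" "blocks w = Suc (blocks w')"
  using block_starts_last_block[of UNIV w] assms unfolding blocks_def by auto

section \<open>Geodesic distance\<close>

lemma (in wf_digraph) awalk_cost_const_1: "awalk_cost (\<lambda>_. 1) p = real (length p)"
  by (induction p) auto

lemma dist_le_length:
  assumes "\<sigma> \<in> words_upto t" "\<tau> \<in> words_upto t"
    and "pre_digraph.awalk (with_proj (sierpinski_graph t)) \<sigma> p \<tau>"
  shows "sierpinski_dist t \<sigma> \<tau> \<le> length p"
proof -
  interpret pair_graph "sierpinski_graph t" by (rule pair_graph_sierpinski)
  have "ereal (sierpinski_dist t \<sigma> \<tau>) \<le> ereal (awalk_cost (\<lambda>_. 1) p)"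
    unfolding sierpinski_dist_ereal[OF assms(1,2)] by (rule min_cost_le_walk_cost[OF assms(3)])
  then show ?thesis by (simp add: awalk_cost_const_1)
qed

lemma le_dist:
  assumes "\<sigma> \<in> words_upto t" "\<tau> \<in> words_upto t"
    and "\<And>p. pre_digraph.awalk (with_proj (sierpinski_graph t)) \<sigma> p \<tau> \<Longrightarrow> c \<le> real (length p)"
  shows "c \<le> sierpinski_dist t \<sigma> \<tau>"
proof -
  interpret pair_graph "sierpinski_graph t" by (rule pair_graph_sierpinski)
  have "ereal c \<le> ereal (sierpinski_dist t \<sigma> \<tau>)"
    unfolding sierpinski_dist_ereal[OF assms(1,2)] \<mu>_def
    by (rule INF_greatest) (use assms(3) in \<open>auto simp: awalk_cost_const_1\<close>)
  then show ?thesis by simp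
qed

lemma dist_step:
  assumes "\<sigma> \<in> words_upto t" "\<rho> \<in> words_upto t" "\<tau> \<in> words_upto t" "touching \<sigma> \<rho>"
  shows "sierpinski_dist t \<sigma> \<tau> \<le> 1 + sierpinski_dist t \<rho> \<tau>"
proof -
  interpret pair_graph "sierpinski_graph t" by (rule pair_graph_sierpinski)
  have "sierpinski_dist t \<sigma> \<tau> - 1 \<le> sierpinski_dist t \<rho> \<tau>"
  proof (rule le_dist)
    fix p assume p: "awalk \<rho> p \<tau>"
    have "(\<sigma>, \<rho>) \<in> parcs (sierpinski_graph t)"
      using assms by (simp add: sierpinski_graph_def)
    with p have "awalk \<sigma> ((\<sigma>, \<rho>) # p) \<tau>"
      by (simp add: awalk_Cons_iff)
    from dist_le_length[OF assms(1,3) this]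
    show "sierpinski_dist t \<sigma> \<tau> - 1 \<le> length p" by simp
  qed (use assms in auto)
  then show ?thesis by simp
qed

text \<open>Every lower bound for the distance is obtained from a potential that changes by at most one
  along each edge.\<close>

lemma lipschitz_le_dist:
  assumes "\<sigma> \<in> words_upto t" "\<tau> \<in> words_upto t"
    and f: "\<And>\<alpha> \<beta>. touching \<alpha> \<beta> \<Longrightarrow> f \<alpha> \<le> f \<beta> + (1 :: real)"
  shows "f \<sigma> - f \<tau> \<le> sierpinski_dist t \<sigma> \<tau>"
proof (rule le_dist)
  interpret pair_graph "sierpinski_graph t" by (rule pair_graph_sierpinski)
  fix p assume "awalk \<sigma> p \<tau>"
  then show "f \<sigma> - f \<tau> \<le> length p"
  proof (induction p arbitrary: \<sigma>)
    case Nil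
    then show ?case by (simp add: awalk_Nil_iff)
  next
    case (Cons e p)
    then have e: "e \<in> parcs (sierpinski_graph t)" "\<sigma> = fst e" "awalk (snd e) p \<tau>"
      by (auto simp: awalk_Cons_iff)
    have "touching \<sigma> (snd e)" using e(1,2) by (auto simp: sierpinski_graph_def)
    from f[OF this] Cons.IH[OF e(3)] show ?case by simp
  qed
qed (use assms in auto)

lemma dist_self:
  assumes "\<sigma> \<in> words_upto t"
  shows "sierpinski_dist t \<sigma> \<sigma> = 0"
proof (rule antisym)
  interpret pair_graph "sierpinski_graph t" by (rule pair_graph_sierpinski)
  have "\<sigma> \<in> pverts (sierpinski_graph t)" using assms by (simp add: sierpinski_graph_def)
  then have "awalk \<sigma> [] \<sigma>" by (simp add: awalk_Nil_iff)
  from dist_le_length[OF assms assms this] show "sierpinski_dist t \<sigma> \<sigma> \<le> 0" by simp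
  show "0 \<le> sierpinski_dist t \<sigma> \<sigma>"
    using lipschitz_le_dist[OF assms assms, of "\<lambda>_. 0"] by simp
qed

text \<open>Removing the last block of a word is a single step of the walk to the root.\<close>

lemma dist_le_via_root:
  assumes "\<sigma> \<in> words_upto t" "\<tau> \<in> words_upto t"
  shows "sierpinski_dist t \<sigma> \<tau> \<le> blocks \<sigma> + sierpinski_dist t [] \<tau>"
  using assms(1)
proof (induction \<sigma> rule: length_induct)
  case (1 \<sigma>)
  show ?case
  proof (cases "\<sigma> = []")
    case False
    then obtain w b where w: "\<sigma> = w @ b" "b \<noteq> []" "set b \<noteq> UNIV" "blocks \<sigma> = Suc (blocks w)"
      by (rule blocks_last_block)
    then have "w \<in> words_upto t" using 1 by (simp add: words_upto_def)
    moreover from this have "sierpinski_dist t w \<tau> \<le> blocks w + sierpinski_dist t [] \<tau>"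
      using 1 w by simp
    moreover have "touching \<sigma> w" unfolding w(1) by (rule touching_append[OF w(3,2)])
    ultimately show ?thesis
      using dist_step[of \<sigma> t w \<tau>] 1 assms(2) w(4) by simp
  qed simp
qed

lemma dist_le_blocks:
  assumes "\<sigma> \<in> words_upto t" "\<tau> \<in> words_upto t"
  shows "sierpinski_dist t \<sigma> \<tau> \<le> real (blocks \<sigma>) + blocks \<tau>"
proof -
  have nil: "[] \<in> words_upto t" by (simp add: words_upto_def)
  show ?thesis
    using dist_le_via_root[OF assms] dist_le_via_root[OF assms(2) nil] dist_self[OF nil]
    by (simp add: sierpinski_dist_commute)
qed

lemma blocks_lipschitz: "touching \<alpha> \<beta> \<Longrightarrow> real (blocks \<alpha>) \<le> real (blocks \<beta>) + 1"
proof (elim touching_suffixes)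
  fix \<rho> u v
  assume "\<alpha> = \<rho> @ u" "\<beta> = \<rho> @ v" "set u \<noteq> UNIV"
  then show ?thesis
    using blocks_append_le[of u \<rho>] blocks_append_ge[of \<rho> v] by simp
qed

text \<open>The potential is \<open>blocks\<close>, made positive on the words below \<open>\<rho> @ [i]\<close> and negative elsewhere. An
  edge between the two regions has its branching point at a prefix of \<open>\<rho>\<close>, so both its ends have at
  most \<open>blocks \<rho> + 1\<close> blocks; subtracting this number and truncating at zero makes the potential
  vanish at both ends, however often a walk changes sides.\<close>

lemma blocks_le_dist_branching:
  assumes "\<sigma> \<in> words_upto t" "\<tau> \<in> words_upto t"
    and "prefix (\<rho> @ [i]) \<sigma>" "\<not> prefix (\<rho> @ [i]) \<tau>"
  shows "real (blocks \<sigma>) + blocks \<tau> - 2 * blocks \<rho> - 2 \<le> sierpinski_dist t \<sigma> \<tau>"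
proof -
  define g where "g w = max 0 (real (blocks w) - blocks \<rho> - 1)" for w
  define f where "f w = (if prefix (\<rho> @ [i]) w then g w else - g w)" for w
  have "f \<alpha> \<le> f \<beta> + 1" if t: "touching \<alpha> \<beta>" for \<alpha> \<beta>
  proof -
    from t obtain \<gamma> u v where uv: "\<alpha> = \<gamma> @ u" "\<beta> = \<gamma> @ v" "set u \<noteq> UNIV" "set v \<noteq> UNIV"
      by (rule touching_suffixes)
    have b: "real (blocks \<alpha>) \<le> blocks \<gamma> + 1" "real (blocks \<beta>) \<le> blocks \<gamma> + 1"
      "blocks \<gamma> \<le> blocks \<alpha>" "blocks \<gamma> \<le> blocks \<beta>"
      using blocks_append_le[of u \<gamma>] blocks_append_le[of v \<gamma>] blocks_append_ge[of \<gamma>] uv by auto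
    show ?thesis
    proof (cases "prefix (\<rho> @ [i]) \<alpha> \<longleftrightarrow> prefix (\<rho> @ [i]) \<beta>")
      case True
      then show ?thesis using b by (auto simp: f_def g_def)
    next
      case False
      then have "\<not> prefix (\<rho> @ [i]) \<gamma>" using uv by (auto intro: prefix_prefix)
      moreover have "prefix (\<rho> @ [i]) (\<gamma> @ u) \<or> prefix (\<rho> @ [i]) (\<gamma> @ v)"
        using False uv by auto
      \<comment> \<open>Prefixes of the same word are comparable.\<close>
      then have "prefix (\<rho> @ [i]) \<gamma> \<or> prefix \<gamma> (\<rho> @ [i])"
        by (metis prefixI prefix_same_cases)
      ultimately have "prefix \<gamma> \<rho>" by (auto simp: prefix_snoc)
      then have "blocks \<gamma> \<le> blocks \<rho>" using blocks_append_ge by (auto simp: prefix_def)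
      with b have "g \<alpha> = 0" "g \<beta> = 0" by (auto simp: g_def)
      then show ?thesis by (simp add: f_def)
    qed
  qed
  then have "f \<sigma> - f \<tau> \<le> sierpinski_dist t \<sigma> \<tau>"
    by (rule lipschitz_le_dist[OF assms(1,2)])
  moreover have "f \<sigma> = g \<sigma>" "f \<tau> = - g \<tau>" using assms(3,4) by (simp_all add: f_def)
  ultimately show ?thesis by (simp add: g_def)
qed

lemma blocks_le_dist:
  assumes "\<sigma> \<in> words_upto t" "\<tau> \<in> words_upto t"
  shows "real (blocks \<sigma>) + blocks \<tau> - 2 * length (longest_common_prefix \<sigma> \<tau>) - 2
    \<le> sierpinski_dist t \<sigma> \<tau>"
proof -
  define \<rho> where "\<rho> = longest_common_prefix \<sigma> \<tau>"
  obtain u v where uv: "\<sigma> = \<rho> @ u" "\<tau> = \<rho> @ v"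
    using longest_common_prefix_prefix1 longest_common_prefix_prefix2
    unfolding \<rho>_def prefix_def by metis
  have len: "blocks \<rho> \<le> length \<rho>" by (rule blocks_le_length)
  show ?thesis
  proof (cases u)
    case Nil
    then have "\<sigma> = \<rho>" using uv by simp
    moreover have "real (blocks \<tau>) - blocks \<sigma> \<le> sierpinski_dist t \<sigma> \<tau>"
      unfolding sierpinski_dist_commute[of t \<sigma>]
      using assms(2,1) blocks_lipschitz by (rule lipschitz_le_dist)
    ultimately show ?thesis using len unfolding \<rho>_def[symmetric] by simp
  next
    case (Cons i u')
    then have p: "prefix (\<rho> @ [i]) \<sigma>" using uv by auto
    have "\<not> prefix (\<rho> @ [i]) \<tau>"
    proof
      assume "prefix (\<rho> @ [i]) \<tau>"
      with p have "prefix (\<rho> @ [i]) \<rho>"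
        unfolding \<rho>_def by (rule longest_common_prefix_max_prefix)
      then show False by (auto dest: prefix_length_le)
    qed
    from blocks_le_dist_branching[OF assms p this] show ?thesis
      using len by (simp add: \<rho>_def)
  qed
qed

section \<open>Summation over all words\<close>

lemma sum_words_upto_Suc:
  fixes h :: "word \<Rightarrow> real"
  shows "(\<Sum>w\<in>words_upto (Suc t). h w) = h [] + (\<Sum>x\<in>UNIV. \<Sum>w\<in>words_upto t. h (x # w))"
proof -
  have eq: "words_upto (Suc t) = insert [] ((\<lambda>(x, w). x # w) ` (UNIV \<times> words_upto t))"
  proof (rule set_eqI)
    fix w :: word
    show "w \<in> words_upto (Suc t) \<longleftrightarrow> w \<in> insert [] ((\<lambda>(x, w). x # w) ` (UNIV \<times> words_upto t))"
      by (cases w) (auto simp: words_upto_def)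
  qed
  have fin: "finite (UNIV :: letter set)" by (simp add: UNIV_letter)
  have "(\<Sum>w\<in>words_upto (Suc t). h w) =
      h [] + (\<Sum>w\<in>(\<lambda>(x, w). x # w) ` (UNIV \<times> words_upto t). h w)"
    unfolding eq by (subst sum.insert) (auto simp: fin finite_words_upto)
  also have "(\<Sum>w\<in>(\<lambda>(x, w). x # w) ` (UNIV \<times> words_upto t). h w) =
      (\<Sum>(x, w)\<in>UNIV \<times> words_upto t. h (x # w))"
    by (subst sum.reindex) (auto simp: inj_on_def case_prod_unfold)
  also have "\<dots> = (\<Sum>x\<in>UNIV. \<Sum>w\<in>words_upto t. h (x # w))"
    by (simp add: sum.cartesian_product)
  finally show ?thesis .
qed

lemma words_upto_0: "words_upto 0 = {[]}"
  by (auto simp: words_upto_def)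

lemma real_card_words_upto: "real (card (words_upto t)) = (3 ^ (t + 1) - 1) / 2"
proof -
  have "real (2 * card (words_upto t) + 1) = real (3 ^ (t + 1))"
    unfolding card_words_upto by (subst le_add_diff_inverse2) simp_all
  then show ?thesis by simp
qed

text \<open>By symmetry these sums depend only on the number of letters in the state. Let \<open>a\<close> and \<open>b\<close> be the
  sums for one and for two letters and \<open>N\<close> the number of words. Distinguishing the first letter
  gives \<open>a(t + 1) = a(t) + 2 b(t)\<close> and \<open>b(t + 1) = a(t) + 2 b(t) + N(t)\<close>, which the closed forms
  solve.\<close>

lemma sum_block_starts:
  shows "(\<Sum>w\<in>words_upto t. real (block_starts {x} w)) = ((2 * t - 3) * 3 ^ t + 3) / 6"
    and "x \<noteq> y \<Longrightarrow> (\<Sum>w\<in>words_upto t. real (block_starts {x, y} w)) = (2 * t * 3 ^ t) / 6"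
proof (induction t arbitrary: x y)
  case 0
  { case 1 show ?case by (simp add: words_upto_0) }
  { case 2 show ?case by (simp add: words_upto_0) }
next
  case (Suc t)
  have c: "insert a {b} = UNIV \<longleftrightarrow> False" "insert a {b, c} = UNIV \<longleftrightarrow> a \<noteq> b \<and> b \<noteq> c \<and> a \<noteq> c"
    for a b c :: letter
    by (cases a; cases b; cases c; auto simp: UNIV_letter)+
  { case 1
    show ?case
      by (cases x) (simp_all add: sum_words_upto_Suc sum_letter c Suc field_simps) }
  { case 2
    then show ?case
      by (cases x; cases y)
         (simp_all add: sum_words_upto_Suc sum_letter c Suc sum.distrib insert_commute
           real_card_words_upto field_simps) }
qed

lemma sum_blocks:
  assumes "t > 0"
  shows "(\<Sum>w\<in>words_upto t. real (blocks w)) = (t + 2) * 3 ^ t / 3"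
proof -
  obtain s where s: "t = Suc s" using assms gr0_conv_Suc by auto
  show ?thesis
    by (simp add: s blocks_def sum_words_upto_Suc sum.distrib sum_block_starts(1)
      card_UNIV_letter real_card_words_upto field_simps)
qed

text \<open>Writing \<open>S\<close> for the double sum and \<open>N\<close> for the number of words, only pairs with the same first
  letter contribute, so \<open>S(t + 1) = 3 (N(t)\<^sup>2 + S(t))\<close>. The bound \<open>N\<^sup>2 / 2\<close> is the one that this recursion
  preserves, as \<open>N(t + 1) > 3 N(t)\<close>.\<close>

lemma sum_common_prefix_le:
  "(\<Sum>\<sigma>\<in>words_upto t. \<Sum>\<tau>\<in>words_upto t. real (length (longest_common_prefix \<sigma> \<tau>)))
    \<le> (real (card (words_upto t)))\<^sup>2 / 2"
proof (induction t)
  case 0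
  show ?case by (simp add: words_upto_0)
next
  case (Suc t)
  let ?S = "\<Sum>\<sigma>\<in>words_upto t. \<Sum>\<tau>\<in>words_upto t. real (length (longest_common_prefix \<sigma> \<tau>))"
  let ?N = "real (card (words_upto t))"
  have N: "real (card (words_upto (Suc t))) = 3 * ?N + 1"
    by (simp add: real_card_words_upto field_simps)
  have "(\<Sum>\<sigma>\<in>words_upto (Suc t). \<Sum>\<tau>\<in>words_upto (Suc t). real (length (longest_common_prefix \<sigma> \<tau>)))
      = 3 * (?N\<^sup>2 + ?S)"
    by (simp add: sum_words_upto_Suc sum_letter sum.distrib power2_eq_square)
  also have "\<dots> \<le> 9 * ?N\<^sup>2 / 2" using Suc by simp
  also have "\<dots> \<le> (3 * ?N + 1)\<^sup>2 / 2" by (simp add: power2_eq_square field_simps)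
  finally show ?case unfolding N .
qed

lemma average_path_length_eq:
  fixes t :: nat
  defines "N \<equiv> real (card (words_upto t))"
  shows "average_path_length t =
    (\<Sum>\<sigma>\<in>words_upto t. \<Sum>\<tau>\<in>words_upto t. sierpinski_dist t \<sigma> \<tau>) / (N * (N - 1))"
proof -
  have "(\<Sum>\<tau>\<in>words_upto t - {\<sigma>}. sierpinski_dist t \<sigma> \<tau>) = (\<Sum>\<tau>\<in>words_upto t. sierpinski_dist t \<sigma> \<tau>)"
    if "\<sigma> \<in> words_upto t" for \<sigma>
    using that by (simp add: sum_diff1 finite_words_upto dist_self)
  then show ?thesis by (simp add: average_path_length_def N_def)
qed

text \<open>The term \<open>3 N\<close> collects the error \<open>2 |\<rho>| + 2\<close> per pair: the first part sums to at most \<open>N\<^sup>2\<close> by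
  \<open>sum_common_prefix_le\<close>, the second to \<open>2 N\<^sup>2\<close>, and a factor \<open>N\<close> cancels.\<close>

lemma average_path_length_bounds:
  fixes t :: nat
  assumes "t > 0"
  defines "N \<equiv> real (card (words_upto t))" and "B \<equiv> (\<Sum>w\<in>words_upto t. real (blocks w))"
  shows "(2 * B - 3 * N) / (N - 1) \<le> average_path_length t"
    and "average_path_length t \<le> 2 * B / (N - 1)"
proof -
  let ?V = "words_upto t"
  let ?D = "\<Sum>\<sigma>\<in>?V. \<Sum>\<tau>\<in>?V. sierpinski_dist t \<sigma> \<tau>"
  have "(3::real) ^ 1 \<le> 3 ^ t" using assms(1) by (intro power_increasing) auto
  then have N: "N > 1" by (simp add: N_def real_card_words_upto)
  have two: "(\<Sum>\<sigma>\<in>?V. \<Sum>\<tau>\<in>?V. real (blocks \<sigma>) + real (blocks \<tau>)) = 2 * N * B"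
    by (simp add: sum.distrib N_def B_def flip: sum_distrib_left)
  have "?D \<le> 2 * N * B"
    unfolding two[symmetric] by (intro sum_mono dist_le_blocks)
  then have "?D / (N * (N - 1)) \<le> 2 * N * B / (N * (N - 1))"
    using N by (intro divide_right_mono) auto
  then show "average_path_length t \<le> 2 * B / (N - 1)"
    unfolding average_path_length_eq using N by (simp add: N_def)
  have "(\<Sum>\<sigma>\<in>?V. \<Sum>\<tau>\<in>?V.
      real (blocks \<sigma>) + blocks \<tau> - 2 * length (longest_common_prefix \<sigma> \<tau>) - 2) =
      (\<Sum>\<sigma>\<in>?V. \<Sum>\<tau>\<in>?V. real (blocks \<sigma>) + blocks \<tau>)
      - 2 * (\<Sum>\<sigma>\<in>?V. \<Sum>\<tau>\<in>?V. real (length (longest_common_prefix \<sigma> \<tau>))) - 2 * N\<^sup>2"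
    unfolding sum_subtractf by (simp add: N_def power2_eq_square flip: sum_distrib_left)
  then have "2 * N * B - 3 * N\<^sup>2 \<le> (\<Sum>\<sigma>\<in>?V. \<Sum>\<tau>\<in>?V.
      real (blocks \<sigma>) + blocks \<tau> - 2 * length (longest_common_prefix \<sigma> \<tau>) - 2)"
    using sum_common_prefix_le[of t] unfolding two N_def[symmetric] by linarith
  also have "\<dots> \<le> ?D" by (intro sum_mono blocks_le_dist)
  finally have "(2 * N * B - 3 * N\<^sup>2) / (N * (N - 1)) \<le> ?D / (N * (N - 1))"
    using N by (intro divide_right_mono) auto
  moreover have "(2 * N * B - 3 * N\<^sup>2) / (N * (N - 1)) = (2 * B - 3 * N) / (N - 1)"
    using N by (simp add: power2_eq_square field_simps)
  ultimately show "(2 * B - 3 * N) / (N - 1) \<le> average_path_length t"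
    unfolding average_path_length_eq by (simp add: N_def)
qed

theorem theorem1:
  shows "(\<lambda>t. average_path_length t / real t) \<longlonglongrightarrow> 4 / 9"
proof (rule tendsto_sandwich)
  define B N where "B t = (real t + 2) * 3 ^ t / 3" and "N t = ((3 :: real) ^ (t + 1) - 1) / 2"
    for t :: nat
  show "\<forall>\<^sub>F t in sequentially.
      (2 * B t - 3 * N t) / (N t - 1) / t \<le> average_path_length t / t"
    using eventually_gt_at_top[of 0]
  proof eventually_elim
    case (elim t)
    then show ?case
      using average_path_length_bounds(1)[OF elim]
      by (intro divide_right_mono) (simp_all add: sum_blocks real_card_words_upto B_def N_def)
  qed
  show "\<forall>\<^sub>F t in sequentially. average_path_length t / t \<le> 2 * B t / (N t - 1) / t"
    using eventually_gt_at_top[of 0]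
  proof eventually_elim
    case (elim t)
    then show ?case
      using average_path_length_bounds(2)[OF elim]
      by (intro divide_right_mono) (simp_all add: sum_blocks real_card_words_upto B_def N_def)
  qed
  show "(\<lambda>t. (2 * B t - 3 * N t) / (N t - 1) / t) \<longlonglongrightarrow> 4 / 9"
    unfolding B_def N_def by real_asymp
  show "(\<lambda>t. 2 * B t / (N t - 1) / t) \<longlonglongrightarrow> 4 / 9"
    unfolding B_def N_def by real_asymp
qed

end
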